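(* (Strong $L^2$ Bonnet--Myers.) Let $X$ be a metric space equipped with a continuous-time random walk $m^{\ast t}$. Let $\varepsilon>0$. Assume that $X$ is $\varepsilon$-geodesic, and that there exist constants $\kappa>0$, $C\geq0$ such that for any two small enough $t,t'$, for any $x,x'\in X$ with $\varepsilon\leq d(x,x')\leq2\varepsilon$ one has $$\mathcal{T}_1(m_x^{\ast t},m_{x'}^{\ast t'})\leq e^{-\kappa\inf(t,t')}\,d(x,x')+\frac{C(\sqrt t-\sqrt{t'})^2}{2d(x,x')}.$$ Assume moreover that $\varepsilon\leq\frac12\sqrt{C/2\kappa}$. Then $$\mathrm{diam}\,X\leq\pi\sqrt{\frac{C}{2\kappa}}\left(1+\frac{4\varepsilon}{\sqrt{C/2\kappa}}\right).$$
   Context: $\sqrt{C/2\kappa}$ means $\sqrt{C/(2\kappa)}$. $(X,d)$ is a Polish metric space with its Borel $\sigma$-algebra. A continuous-time random walk on $X$ is a continuous-time Markov chain; $m_x^{\ast t}$ denotes its law at time $t\geq0$ when started at $x$, a probability measure on $X$ with $m_x^{\ast0}=\delta_x$. The $L^1$ transportation distance is $\mathcal{T}_1(\nu_1,\nu_2):=\inf_{\xi}\int_{X\times X} d(x,y)\,\mathrm{d}\xi(x,y)$, over all measures $\xi$ on $X\times X$ with marginals $\nu_1,\nu_2$. $X$ is $\varepsilon$-geodesic if for any $x,y\in X$ there exist an integer $n$ and a sequence $x_0=x,x_1,\ldots,x_n=y$ in $X$ with $d(x_i,x_{i+1})\leq\varepsilon$ and $d(x,y)=\sum d(x_i,x_{i+1})$.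 "For any two small enough $t,t'$" means that there is $t_0>0$ such that the inequality holds for all $t,t'\in[0,t_0]$ and all such $x,x'$. *)

theory Defs
  imports "HOL-Probability.Probability"
begin

text \<open>
  A time-homogeneous continuous-time Markov chain is given by its transition semigroup:
  \<open>m t x\<close> is the law at time \<open>t\<close> of the chain started at \<open>x\<close>. Only the values at \<open>t \<ge> 0\<close>
  matter. No moment condition is imposed on \<open>m t x\<close>.
\<close>

definition continuous_time_random_walk ::
  "(real \<Rightarrow> 'a::polish_space \<Rightarrow> 'a measure) \<Rightarrow> bool" where
  "continuous_time_random_walk m \<longleftrightarrow>
     (\<forall>t\<ge>0. m t \<in> borel \<rightarrow>\<^sub>M prob_algebra borel) \<and>
     (\<forall>x. m 0 x = return borel x) \<and>
     (\<forall>s\<ge>0. \<forall>t\<ge>0. \<forall>x. m (s + t) x = m s x \<bind> m t)"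

definition couplings ::
  "'a::polish_space measure \<Rightarrow> 'a measure \<Rightarrow> ('a \<times> 'a) measure set" where
  "couplings \<mu> \<nu> =
     {\<xi>. sets \<xi> = sets borel \<and> distr \<xi> borel fst = \<mu> \<and> distr \<xi> borel snd = \<nu>}"

text \<open>
  The distance is \<open>ennreal\<close>-valued, since it may be infinite for measures without first moment.
\<close>

definition transport_dist ::
  "'a::polish_space measure \<Rightarrow> 'a measure \<Rightarrow> ennreal" where
  "transport_dist \<mu> \<nu> =
     (INF \<xi>\<in>couplings \<mu> \<nu>. \<integral>\<^sup>+ p. ennreal (dist (fst p) (snd p)) \<partial>\<xi>)"

definition eps_geodesic :: "real \<Rightarrow> 'a::metric_space itself \<Rightarrow> bool" where
  "eps_geodesic \<epsilon> _ \<longleftrightarrow>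
     (\<forall>x y :: 'a. \<exists>(n::nat) (z :: nat \<Rightarrow> 'a).
        z 0 = x \<and> z n = y \<and>
        (\<forall>i<n. dist (z i) (z (Suc i)) \<le> \<epsilon>) \<and>
        dist x y = (\<Sum>i<n. dist (z i) (z (Suc i))))"

end

theory Submission
  imports Defs
begin

text \<open>
  Along an almost geodesic chain from \<open>x\<close> to \<open>x'\<close> of length \<open>D\<close>, let the point at distance \<open>s\<close>
  from \<open>x\<close> diffuse for the time \<open>\<eta> sin\<^sup>2 (\<pi> s / D)\<close>, which vanishes at both ends. Testing the
  couplings between consecutive laws against the truncated distance to \<open>x\<close> shows that \<open>D\<close> is at
  most the sum of the transport distances; this replaces the triangle inequality for \<open>\<T>\<^sub>1\<close> and so
  avoids gluing of couplings. The first order terms in \<open>\<eta>\<close> give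
  \<open>\<kappa> \<integral> sin\<^sup>2 \<le> (C \<pi>\<^sup>2 / 2 D\<^sup>2) \<integral> cos\<^sup>2\<close> up to the discretisation error of the left-hand side, hence
  \<open>D (D - 2 \<pi> \<epsilon>) \<le> \<pi>\<^sup>2 C / 2 \<kappa>\<close>. A chain with steps in \<open>[\<epsilon>, 2 \<epsilon>]\<close> need not reach \<open>x'\<close>, but it
  ends at distance less than \<open>\<epsilon>\<close> from it.
\<close>

section \<open>Discretised integrals of \<open>cos\<close>-squared and
  \<open>sin\<close>-squared\<close>

lemma sin_diff_sq_le:
  fixes a b :: real
  assumes "a < b"
  shows "(sin b - sin a)\<^sup>2 / (b - a) \<le> (b - a) / 2 + (sin (2 * b) - sin (2 * a)) / 4"
proof -
  \<comment> \<open>Cauchy--Schwarz for \<open>\<integral> cos\<close>: integrate \<open>(cos x - l)\<^sup>2 \<ge> 0\<close> for the mean value \<open>l\<close> of \<open>cos\<close>.\<close>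
  define l where "l = (sin b - sin a) / (b - a)"
  define g where "g x = x / 2 + sin (2 * x) / 4 - 2 * l * sin x + l\<^sup>2 * x" for x :: real
  have deriv: "(g has_real_derivative (cos x - l)\<^sup>2) (at x)" for x
    unfolding g_def
    by (rule derivative_eq_intros refl | simp)+
       (use cos_double_cos[of x] in \<open>simp add: power2_eq_square field_simps\<close>)
  have "g a \<le> g b"
  proof (rule DERIV_nonneg_imp_nondecreasing[OF less_imp_le[OF assms]])
    show "\<exists>y. (g has_real_derivative y) (at x) \<and> 0 \<le> y" for x
      using deriv[of x] by (intro exI conjI) auto
  qed
  moreover have "l * (sin b - sin a) = (sin b - sin a)\<^sup>2 / (b - a)"
      and "l\<^sup>2 * (b - a) = (sin b - sin a)\<^sup>2 / (b - a)"
    using assms by (simp_all add: l_def power2_eq_square)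
  ultimately show ?thesis
    by (simp add: g_def algebra_simps diff_divide_distrib add_divide_distrib)
qed

lemma abs_sin_sq_diff_le:
  fixes x y :: real
  shows "\<bar>(sin x)\<^sup>2 - (sin y)\<^sup>2\<bar> \<le> \<bar>x - y\<bar>"
proof -
  have "(sin x)\<^sup>2 - (sin y)\<^sup>2 = sin (x + y) * sin (x - y)"
  proof -
    have "sin (x + y) * sin (x - y) = (sin x)\<^sup>2 * (cos y)\<^sup>2 - (cos x)\<^sup>2 * (sin y)\<^sup>2"
      by (simp add: sin_add sin_diff power2_eq_square algebra_simps)
    then show ?thesis
      by (simp add: cos_squared_eq algebra_simps)
  qed
  moreover have "\<bar>sin (x + y)\<bar> * \<bar>sin (x - y)\<bar> \<le> 1 * \<bar>x - y\<bar>"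
    by (intro mult_mono abs_sin_x_le_abs_x) auto
  ultimately show ?thesis
    by (simp add: abs_mult)
qed

text \<open>The left-hand side is the integral of \<open>(sin x)^2\<close> over
  \<open>[a, b]\<close>. Since \<open>(sin x)^2\<close> is 1-Lipschitz, it exceeds its value at
  either endpoint by at most the distance to that endpoint, and integrating this distance gives the
  quadratic error. Both endpoints are treated because the minimum can be attained at either
  one.\<close>

lemma sin_sq_integral_le:
  fixes a b :: real
  assumes "a \<le> b"
  shows "(b - a) / 2 - (sin (2 * b) - sin (2 * a)) / 4
           \<le> (b - a) * min ((sin a)\<^sup>2) ((sin b)\<^sup>2) + (b - a)\<^sup>2 / 2"
proof -
  have 1: "(b - a) / 2 - (sin (2 * b) - sin (2 * a)) / 4 \<le> (b - a) * (sin a)\<^sup>2 + (b - a)\<^sup>2 / 2"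
  proof -
    define g where "g x = (x - a)\<^sup>2 / 2 + (x - a) * (sin a)\<^sup>2 - x / 2 + sin (2 * x) / 4" for x :: real
    have deriv: "(g has_real_derivative ((x - a) + (sin a)\<^sup>2 - (sin x)\<^sup>2)) (at x)" for x
      unfolding g_def
      by (rule derivative_eq_intros refl | simp)+
         (use cos_double_sin[of x] in \<open>simp add: power2_eq_square field_simps\<close>)
    have "g a \<le> g b"
    proof (rule DERIV_nonneg_imp_nondecreasing[OF assms])
      fix x assume "a \<le> x"
      then show "\<exists>y. (g has_real_derivative y) (at x) \<and> 0 \<le> y"
        using deriv[of x] abs_sin_sq_diff_le[of x a] by (intro exI conjI) auto
    qed
    then show ?thesis
      by (simp add: g_def algebra_simps diff_divide_distrib add_divide_distrib)
  qed
  have 2: "(b - a) / 2 - (sin (2 * b) - sin (2 * a)) / 4 \<le> (b - a) * (sin b)\<^sup>2 + (b - a)\<^sup>2 / 2"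
  proof -
    define g where "g x = - ((b - x)\<^sup>2 / 2) + (x - b) * (sin b)\<^sup>2 - x / 2 + sin (2 * x) / 4"
      for x :: real
    have deriv: "(g has_real_derivative ((b - x) + (sin b)\<^sup>2 - (sin x)\<^sup>2)) (at x)" for x
      unfolding g_def
      by (rule derivative_eq_intros refl | simp)+
         (use cos_double_sin[of x] in \<open>simp add: power2_eq_square field_simps\<close>)
    have "g a \<le> g b"
    proof (rule DERIV_nonneg_imp_nondecreasing[OF assms])
      fix x assume "x \<le> b"
      then show "\<exists>y. (g has_real_derivative y) (at x) \<and> 0 \<le> y"
        using deriv[of x] abs_sin_sq_diff_le[of x b] by (intro exI conjI) auto
    qed
    then show ?thesis
      by (simp add: g_def algebra_simps diff_divide_distrib add_divide_distrib)
  qed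
  from 1 2 show ?thesis
    by (auto simp: min_def)
qed

text \<open>The Cauchy-Schwarz bounds on the single intervals telescope to the integral of
  \<open>(cos x)^2\<close> over \<open>[0, pi]\<close>; \<open>G\<close> is the antiderivative
  evaluated at the nodes.\<close>

lemma sum_sin_diff_sq_le:
  fixes a :: "nat \<Rightarrow> real"
  assumes "a 0 = 0" "a k = pi" "\<And>i. i < k \<Longrightarrow> a i < a (Suc i)"
  shows "(\<Sum>i<k. (sin (a (Suc i)) - sin (a i))\<^sup>2 / (a (Suc i) - a i)) \<le> pi / 2"
proof -
  define G where "G i = a i / 2 + sin (2 * a i) / 4" for i
  have "(\<Sum>i<k. (sin (a (Suc i)) - sin (a i))\<^sup>2 / (a (Suc i) - a i)) \<le> (\<Sum>i<k. G (Suc i) - G i)"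
    using sin_diff_sq_le[OF assms(3)]
    by (intro sum_mono) (fastforce simp: G_def diff_divide_distrib)
  also have "\<dots> = pi / 2"
    unfolding sum_lessThan_telescope using assms by (simp add: G_def)
  finally show ?thesis .
qed

lemma sum_min_sin_sq_ge:
  fixes a :: "nat \<Rightarrow> real"
  assumes "a 0 = 0" "a k = pi" "\<And>i. i < k \<Longrightarrow> a i \<le> a (Suc i)"
    and "\<And>i. i < k \<Longrightarrow> a (Suc i) - a i \<le> h"
  shows "pi / 2 * (1 - h)
           \<le> (\<Sum>i<k. (a (Suc i) - a i) * min ((sin (a i))\<^sup>2) ((sin (a (Suc i)))\<^sup>2))"
proof -
  \<comment> \<open>An antiderivative of \<open>(sin x)^2\<close> at the nodes, minus a linear term:
    with mesh at most \<open>h\<close> the quadratic error on an interval is at most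
    \<open>h / 2\<close> times its length, so it telescopes too.\<close>
  define F where "F i = a i / 2 - sin (2 * a i) / 4 - h / 2 * a i" for i
  have "pi / 2 * (1 - h) = (\<Sum>i<k. F (Suc i) - F i)"
    unfolding sum_lessThan_telescope using assms by (simp add: F_def field_simps)
  also have "\<dots> \<le> (\<Sum>i<k. (a (Suc i) - a i) * min ((sin (a i))\<^sup>2) ((sin (a (Suc i)))\<^sup>2))"
  proof (intro sum_mono)
    fix i assume "i \<in> {..<k}"
    then have i: "a i \<le> a (Suc i)" "a (Suc i) - a i \<le> h"
      using assms by auto
    then have "(a (Suc i) - a i)\<^sup>2 \<le> h * (a (Suc i) - a i)"
      unfolding power2_eq_square by (intro mult_right_mono) auto
    with sin_sq_integral_le[OF i(1)]
    show "F (Suc i) - F i \<le> (a (Suc i) - a i) * min ((sin (a i))\<^sup>2) ((sin (a (Suc i)))\<^sup>2)"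
      by (simp add: F_def algebra_simps diff_divide_distrib)
  qed
  finally show ?thesis .
qed

section \<open>Coarse chains in an \<epsilon>-geodesic space\<close>

text \<open>Greedy selection: an index is kept as soon as the gap to the last kept one reaches
  \<open>\<epsilon>\<close>. Just before, the gap was below \<open>\<epsilon>\<close>, and one step
  adds at most \<open>\<epsilon>\<close>.\<close>

lemma ex_coarse_subsequence:
  fixes s :: "nat \<Rightarrow> real"
  assumes "\<epsilon> > 0" "\<And>i. i < n \<Longrightarrow> s (Suc i) - s i \<le> \<epsilon>"
  shows "\<exists>k \<sigma>. \<sigma> 0 = 0 \<and> (\<forall>i\<le>k. \<sigma> i \<le> n) \<and> s n - s (\<sigma> k) < \<epsilon> \<and>
           (\<forall>i<k. \<epsilon> \<le> s (\<sigma> (Suc i)) - s (\<sigma> i) \<and> s (\<sigma> (Suc i)) - s (\<sigma> i) \<le> 2 * \<epsilon>)"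
  using assms(2)
proof (induction n)
  case 0
  show ?case
    using assms(1) by (intro exI[of _ 0] exI[of _ "\<lambda>_. 0"]) auto
next
  case (Suc n)
  then obtain k \<sigma> where IH: "\<sigma> 0 = 0" "\<forall>i\<le>k. \<sigma> i \<le> n" "s n - s (\<sigma> k) < \<epsilon>"
    "\<forall>i<k. \<epsilon> \<le> s (\<sigma> (Suc i)) - s (\<sigma> i) \<and> s (\<sigma> (Suc i)) - s (\<sigma> i) \<le> 2 * \<epsilon>"
    by (metis less_Suc_eq)
  show ?case
  proof (cases "s (Suc n) - s (\<sigma> k) < \<epsilon>")
    case True
    with IH show ?thesis
      by (intro exI[of _ k] exI[of _ \<sigma>]) (auto simp: le_Suc_eq)
  next
    case False
    have "s (Suc n) - s n \<le> \<epsilon>"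
      using Suc.prems by simp
    with False IH assms(1) show ?thesis
      by (intro exI[of _ "Suc k"] exI[of _ "\<sigma>(Suc k := Suc n)"])
         (auto simp: le_Suc_eq less_Suc_eq)
  qed
qed

text \<open>The triangle inequality bounds each of the three stretches cut out by \<open>i\<close>
  and \<open>j\<close> by its chain length. As the whole chain realises the distance of its ends,
  none of these bounds can be strict.\<close>

lemma dist_along_geodesic_chain:
  fixes z :: "nat \<Rightarrow> 'a::metric_space"
  assumes "dist (z 0) (z n) = (\<Sum>i<n. dist (z i) (z (Suc i)))" "i \<le> j" "j \<le> n"
  shows "dist (z i) (z j) = (\<Sum>l<j. dist (z l) (z (Suc l))) - (\<Sum>l<i. dist (z l) (z (Suc l)))"
proof -
  define s where "s j = (\<Sum>l<j. dist (z l) (z (Suc l)))" for j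
  have le: "dist (z i) (z j) \<le> s j - s i" if "i \<le> j" for i j
    using that
  proof (induction j rule: dec_induct)
    case (step j)
    then show ?case
      using dist_triangle[of "z i" "z (Suc j)" "z j"] by (simp add: s_def)
  qed simp
  have "s n \<le> dist (z 0) (z i) + dist (z i) (z j) + dist (z j) (z n)"
    using assms(1) dist_triangle[of "z 0" "z n" "z i"] dist_triangle[of "z i" "z n" "z j"]
    by (simp add: s_def)
  moreover have "dist (z 0) (z i) \<le> s i" "dist (z j) (z n) \<le> s n - s j"
    using le[of 0 i] le[of j n] assms by (auto simp: s_def)
  ultimately show ?thesis
    using le[OF assms(2)] by (simp add: s_def)
qed

lemma eps_geodesic_coarse_chain:
  fixes x y :: "'a::metric_space"
  assumes "eps_geodesic \<epsilon> TYPE('a)" "\<epsilon> > 0"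
  obtains k and w :: "nat \<Rightarrow> 'a" and u :: "nat \<Rightarrow> real" where
    "w 0 = x" "u 0 = 0" "dist x y < u k + \<epsilon>" "dist x (w k) = u k"
    "\<And>i. i < k \<Longrightarrow> dist (w i) (w (Suc i)) = u (Suc i) - u i"
    "\<And>i. i < k \<Longrightarrow> \<epsilon> \<le> u (Suc i) - u i" "\<And>i. i < k \<Longrightarrow> u (Suc i) - u i \<le> 2 * \<epsilon>"
proof -
  obtain n z where z: "z 0 = x" "z n = y" "\<forall>i<n. dist (z i) (z (Suc i)) \<le> \<epsilon>"
    "dist x y = (\<Sum>i<n. dist (z i) (z (Suc i)))"
    using assms(1) unfolding eps_geodesic_def by blast
  define s where "s j = (\<Sum>l<j. dist (z l) (z (Suc l)))" for j
  have dist_s: "dist (z i) (z j) = s j - s i" if "i \<le> j" "j \<le> n" for i j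
    using dist_along_geodesic_chain[of z n i j] z that by (simp add: s_def)
  obtain k \<sigma> where \<sigma>: "\<sigma> 0 = 0" "\<forall>i\<le>k. \<sigma> i \<le> n" "s n - s (\<sigma> k) < \<epsilon>"
    "\<forall>i<k. \<epsilon> \<le> s (\<sigma> (Suc i)) - s (\<sigma> i) \<and> s (\<sigma> (Suc i)) - s (\<sigma> i) \<le> 2 * \<epsilon>"
    using ex_coarse_subsequence[OF assms(2), of n s] z(3) by (auto simp: s_def)
  \<comment> \<open>The greedy selection does not record that \<open>\<sigma>\<close> is increasing;
    this follows because \<open>s\<close> is nondecreasing and the selected gaps are
    positive.\<close>
  have mono: "\<sigma> i \<le> \<sigma> (Suc i)" if "i < k" for i
  proof (rule ccontr)
    assume "\<not> \<sigma> i \<le> \<sigma> (Suc i)"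
    then have "s (\<sigma> (Suc i)) \<le> s (\<sigma> i)"
      unfolding s_def by (intro sum_mono2) auto
    moreover have "\<epsilon> \<le> s (\<sigma> (Suc i)) - s (\<sigma> i)"
      using \<sigma>(4) that by auto
    ultimately show False
      using assms(2) by linarith
  qed
  show thesis
  proof (rule that[of "\<lambda>i. z (\<sigma> i)" "\<lambda>i. s (\<sigma> i)" k])
    show "dist x y < s (\<sigma> k) + \<epsilon>"
      using \<sigma>(3) z(4) by (simp add: s_def)
    show "dist x (z (\<sigma> k)) = s (\<sigma> k)"
      using dist_s[of 0 "\<sigma> k"] \<sigma> z(1) by (simp add: s_def)
    show "dist (z (\<sigma> i)) (z (\<sigma> (Suc i))) = s (\<sigma> (Suc i)) - s (\<sigma> i)" if "i < k" for i
      using dist_s mono \<sigma>(2) that by simp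
  qed (use \<sigma> z in \<open>auto simp: s_def\<close>)
qed

section \<open>Lipschitz test functions and transport distance\<close>

text \<open>The easy half of Kantorovich duality. Boundedness of \<open>f\<close> secures
  integrability without any moment condition.\<close>

lemma transport_dist_ge_lipschitz:
  fixes \<mu> \<nu> :: "'a::polish_space measure" and f :: "'a \<Rightarrow> real"
  assumes "prob_space \<mu>"
    and f: "f \<in> borel_measurable borel" "\<And>x. \<bar>f x\<bar> \<le> B" "\<And>x y. f y - f x \<le> dist x y"
  shows "ennreal (integral\<^sup>L \<nu> f - integral\<^sup>L \<mu> f) \<le> transport_dist \<mu> \<nu>"
  unfolding transport_dist_def
proof (rule INF_greatest)
  fix \<xi> assume "\<xi> \<in> couplings \<mu> \<nu>"
  then have \<xi>: "sets \<xi> = sets borel" "distr \<xi> borel fst = \<mu>" "distr \<xi> borel snd = \<nu>"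
    by (auto simp: couplings_def)
  note [measurable_cong] = \<xi>(1)
  have [measurable]: "fst \<in> \<xi> \<rightarrow>\<^sub>M (borel :: 'a measure)" "snd \<in> \<xi> \<rightarrow>\<^sub>M (borel :: 'a measure)"
    by (auto simp: measurable_cong_sets[OF \<xi>(1) refl]
             intro!: borel_measurable_continuous_onI continuous_intros)
  note [measurable] = f(1)
  \<comment> \<open>Total mass one is not part of \<open>couplings\<close>; it is inherited from the
    first marginal.\<close>
  interpret prob_space \<xi>
    using prob_space_distrD[of fst \<xi> borel] assms(1) \<xi>(2) by simp
  have int: "integrable \<xi> (\<lambda>p. f (fst p))" "integrable \<xi> (\<lambda>p. f (snd p))"
    using f(2) by (auto intro!: integrable_const_bound[where B = B])
  have eq: "integral\<^sup>L \<nu> f - integral\<^sup>L \<mu> f = (\<integral>p. f (snd p) - f (fst p) \<partial>\<xi>)"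
    using int by (simp add: \<xi>(2,3)[symmetric] integral_distr)
  have "ennreal (integral\<^sup>L \<nu> f - integral\<^sup>L \<mu> f)
      \<le> ennreal (norm (\<integral>p. f (snd p) - f (fst p) \<partial>\<xi>))"
    unfolding eq by (intro ennreal_leI) simp
  also have "\<dots> \<le> (\<integral>\<^sup>+p. ennreal (norm (f (snd p) - f (fst p))) \<partial>\<xi>)"
    using int by (intro integral_norm_bound_ennreal) auto
  also have "\<dots> \<le> (\<integral>\<^sup>+p. ennreal (dist (fst p) (snd p)) \<partial>\<xi>)"
  proof (intro nn_integral_mono ennreal_leI)
    show "norm (f (snd p) - f (fst p)) \<le> dist (fst p) (snd p)" for p
      using f(3)[of "snd p" "fst p"] f(3)[of "fst p" "snd p"] by (simp add: abs_le_iff dist_commute)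
  qed
  finally show "ennreal (integral\<^sup>L \<nu> f - integral\<^sup>L \<mu> f)
      \<le> (\<integral>\<^sup>+p. ennreal (dist (fst p) (snd p)) \<partial>\<xi>)" .
qed

lemma dist_le_sum_transport_dist:
  fixes \<mu> :: "nat \<Rightarrow> 'a::polish_space measure"
  assumes "\<And>i. i < k \<Longrightarrow> prob_space (\<mu> i)"
    and "\<mu> 0 = return borel x" "\<mu> k = return borel y"
    and bd: "\<And>i. i < k \<Longrightarrow> transport_dist (\<mu> i) (\<mu> (Suc i)) \<le> ennreal (c i)"
    and nonneg: "\<And>i. i < k \<Longrightarrow> 0 \<le> c i"
  shows "dist x y \<le> (\<Sum>i<k. c i)"
proof -
  \<comment> \<open>Truncating at \<open>dist x y\<close> makes the test function bounded, yet keeps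
    its values \<open>0\<close> at \<open>x\<close> and \<open>dist x y\<close> at
    \<open>y\<close>.\<close>
  define f where "f z = min (dist x z) (dist x y)" for z
  have meas: "f \<in> borel_measurable borel"
    unfolding f_def by measurable
  have step: "integral\<^sup>L (\<mu> (Suc i)) f - integral\<^sup>L (\<mu> i) f \<le> c i" if "i < k" for i
  proof -
    have "ennreal (integral\<^sup>L (\<mu> (Suc i)) f - integral\<^sup>L (\<mu> i) f) \<le> ennreal (c i)"
    proof (rule order_trans[OF transport_dist_ge_lipschitz bd[OF that]])
      show "f b - f a \<le> dist a b" for a b
        using dist_triangle[of x b a] zero_le_dist[of a b]
        unfolding f_def by linarith
      show "\<bar>f a\<bar> \<le> dist x y" for a
        by (auto simp: f_def)
    qed (use assms(1) that meas in auto)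
    \<comment> \<open>As \<open>ennreal\<close> sends negative reals to \<open>0\<close>, returning
      to the reals relies on \<open>0 \<le> c i\<close>.\<close>
    then show ?thesis
      using nonneg[OF that] by (simp only: ennreal_le_iff)
  qed
  have "dist x y = integral\<^sup>L (\<mu> k) f - integral\<^sup>L (\<mu> 0) f"
    using meas by (simp add: assms(2,3) integral_return f_def)
  also have "\<dots> = (\<Sum>i<k. integral\<^sup>L (\<mu> (Suc i)) f - integral\<^sup>L (\<mu> i) f)"
    by (rule sum_lessThan_telescope[symmetric])
  also have "\<dots> \<le> (\<Sum>i<k. c i)"
    using step by (intro sum_mono) auto
  finally show ?thesis .
qed

section \<open>First-order comparison in the diffusion time\<close>

lemma exp_minus_le_quadratic:
  fixes x :: real
  assumes "0 \<le> x"
  shows "exp (- x) \<le> 1 - x + x\<^sup>2"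
proof -
  have "exp (- x) \<le> 1 / (1 + x)"
    using exp_ge_add_one_self[of x] assms by (simp add: exp_minus field_simps)
  \<comment> \<open>This is \<open>(1 + x) * (1 - x + x^2) = 1 + x^3 \<ge> 1\<close>.\<close>
  also have "\<dots> \<le> 1 - x + x\<^sup>2"
    using assms by (simp add: field_simps power2_eq_square)
  finally show ?thesis .
qed

lemma le_if_le_add_small_multiple:
  fixes A B K :: real
  assumes "t > 0" "\<And>\<eta>. 0 < \<eta> \<Longrightarrow> \<eta> \<le> t \<Longrightarrow> A \<le> B + \<eta> * K"
  shows "A \<le> B"
proof (rule tendsto_lowerbound)
  show "((\<lambda>\<eta>. B + \<eta> * K) \<longlongrightarrow> B) (at_right 0)"
    by (auto intro!: tendsto_eq_intros)
  show "\<forall>\<^sub>F \<eta> in at_right 0. A \<le> B + \<eta> * K"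
    using assms by (auto simp: eventually_at_right_field intro!: exI[of _ t])
qed simp

lemma coarse_chain_length_le:
  fixes m :: "real \<Rightarrow> 'a::polish_space \<Rightarrow> 'a measure"
    and w :: "nat \<Rightarrow> 'a" and u :: "nat \<Rightarrow> real"
  assumes rw: "continuous_time_random_walk m"
    and "\<epsilon> > 0" "\<kappa> > 0" "C \<ge> 0" "t\<^sub>0 > 0"
    and contr: "\<And>t t' x x'. \<lbrakk>t \<in> {0..t\<^sub>0}; t' \<in> {0..t\<^sub>0}; \<epsilon> \<le> dist x x'; dist x x' \<le> 2 * \<epsilon>\<rbrakk> \<Longrightarrow>
           transport_dist (m t x) (m t' x')
             \<le> ennreal (exp (- \<kappa> * min t t') * dist x x'
                        + C * (sqrt t - sqrt t')\<^sup>2 / (2 * dist x x'))"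
    and u: "u 0 = 0" "u k > 0" "dist (w 0) (w k) = u k"
    and step: "\<And>i. i < k \<Longrightarrow> dist (w i) (w (Suc i)) = u (Suc i) - u i"
      "\<And>i. i < k \<Longrightarrow> \<epsilon> \<le> u (Suc i) - u i" "\<And>i. i < k \<Longrightarrow> u (Suc i) - u i \<le> 2 * \<epsilon>"
  shows "u k * (u k - 2 * pi * \<epsilon>) \<le> pi\<^sup>2 * (C / (2 * \<kappa>))"
proof -
  define D where "D = u k"
  define a where "a i = pi * u i / D" for i
  define d where "d i = u (Suc i) - u i" for i
  \<comment> \<open>Up to the factor \<open>\<eta>\<close>, \<open>p\<close> is the minimum of two
    consecutive times and \<open>q\<close> the squared difference of their square roots, the two
    quantities in the contraction bound.\<close>
  define p where "p i = min ((sin (a i))\<^sup>2) ((sin (a (Suc i)))\<^sup>2)" for i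
  define q where "q i = (sin (a (Suc i)) - sin (a i))\<^sup>2" for i
  have D: "D > 0"
    using u by (simp add: D_def)
  have d_bounds: "\<epsilon> \<le> d i" "d i \<le> 2 * \<epsilon>" "0 < d i" if "i < k" for i
    using step(2,3)[OF that] \<open>\<epsilon> > 0\<close> by (auto simp: d_def)
  have sum_d: "(\<Sum>i<k. d i) = D"
    by (simp add: d_def sum_lessThan_telescope u D_def)
  have a0: "a 0 = 0" and ak: "a k = pi"
    using u(2) by (auto simp: a_def u(1) D_def)
  have a_step: "a (Suc i) - a i = pi * d i / D" for i
    by (simp add: a_def d_def diff_divide_distrib right_diff_distrib)
  have a_less: "a i < a (Suc i)" if "i < k" for i
    using a_step[of i] d_bounds(3)[OF that] D by (smt (verit) pi_gt_zero divide_pos_pos mult_pos_pos)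
  have u_ge: "0 \<le> u i" and u_le: "u i \<le> D" if "i \<le> k" for i
  proof -
    have *: "u i = (\<Sum>j<i. d j)"
      by (simp add: d_def sum_lessThan_telescope u)
    show "0 \<le> u i"
      unfolding * using d_bounds(3) that by (intro sum_nonneg) (auto intro: less_imp_le)
    show "u i \<le> D"
      unfolding * sum_d[symmetric] using d_bounds(3) that
      by (intro sum_mono2) (auto intro: less_imp_le)
  qed
  \<comment> \<open>Needed so that the square root of the time \<open>\<eta> * (sin (a i))^2\<close>
    is a multiple of \<open>sin (a i)\<close> without absolute value.\<close>
  have sin_nonneg: "0 \<le> sin (a i)" if "i \<le> k" for i
    using u_ge[OF that] u_le[OF that] D by (intro sin_ge_zero) (auto simp: a_def field_simps)
  \<comment> \<open>The comparison holds for each small \<open>\<eta>\<close> with an error linear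
    in \<open>\<eta>\<close>, which vanishes in the limit.\<close>
  have key: "\<kappa> * (\<Sum>i<k. d i * p i) \<le> C / 2 * (\<Sum>i<k. q i / d i)"
  proof (rule le_if_le_add_small_multiple[OF \<open>t\<^sub>0 > 0\<close>])
    fix \<eta> :: real assume \<eta>: "0 < \<eta>" "\<eta> \<le> t\<^sub>0"
    define t where "t i = \<eta> * (sin (a i))\<^sup>2" for i
    define c where "c i = exp (- \<kappa> * min (t i) (t (Suc i))) * d i
                     + C * (sqrt (t i) - sqrt (t (Suc i)))\<^sup>2 / (2 * d i)" for i
    have t: "t i \<in> {0..t\<^sub>0}" for i
      using \<eta> mult_mono[of \<eta> t\<^sub>0 "(sin (a i))\<^sup>2" 1] by (simp add: t_def abs_square_le_1)
    have "dist (w 0) (w k) \<le> (\<Sum>i<k. c i)"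
    proof (rule dist_le_sum_transport_dist[where \<mu> = "\<lambda>i. m (t i) (w i)"])
      show "prob_space (m (t i) (w i))" for i
      proof -
        have "m (t i) \<in> borel \<rightarrow>\<^sub>M prob_algebra borel"
          using rw t[of i] unfolding continuous_time_random_walk_def by auto
        then have "m (t i) (w i) \<in> space (prob_algebra borel)"
          by (rule measurable_space) simp
        then show ?thesis
          by (simp add: space_prob_algebra)
      qed
      show "m (t 0) (w 0) = return borel (w 0)" "m (t k) (w k) = return borel (w k)"
        using rw by (auto simp: continuous_time_random_walk_def t_def a0 ak)
      show "transport_dist (m (t i) (w i)) (m (t (Suc i)) (w (Suc i))) \<le> ennreal (c i)"
        if "i < k" for i
        using contr[OF t t, of "w i" "w (Suc i)" i "Suc i"] step[OF that] by (simp add: c_def d_def)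
      show "0 \<le> c i" if "i < k" for i
        using d_bounds(3)[OF that] \<open>C \<ge> 0\<close> by (simp add: c_def)
    qed
    also have "(\<Sum>i<k. c i)
        \<le> (\<Sum>i<k. d i - \<eta> * \<kappa> * (d i * p i) + \<eta>\<^sup>2 * \<kappa>\<^sup>2 * d i + \<eta> * (C / 2) * (q i / d i))"
    proof (rule sum_mono)
      fix i assume "i \<in> {..<k}"
      then have i: "i < k" by simp
      have p: "0 \<le> p i" "p i \<le> 1"
        by (auto simp: p_def min_def abs_square_le_1)
      have "min (t i) (t (Suc i)) = \<eta> * p i"
        using \<eta> by (simp add: t_def p_def min_mult_distrib_left)
      then have "exp (- \<kappa> * min (t i) (t (Suc i))) \<le> 1 - \<kappa> * (\<eta> * p i) + (\<kappa> * (\<eta> * p i))\<^sup>2"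
        using exp_minus_le_quadratic[of "\<kappa> * (\<eta> * p i)"] p \<eta> \<open>\<kappa> > 0\<close> by simp
      also have "(\<kappa> * (\<eta> * p i))\<^sup>2 \<le> (\<kappa> * (\<eta> * 1))\<^sup>2"
        using p \<eta> \<open>\<kappa> > 0\<close> by (intro power_mono mult_left_mono) auto
      finally have "exp (- \<kappa> * min (t i) (t (Suc i))) * d i
          \<le> (1 - \<kappa> * (\<eta> * p i) + (\<kappa> * \<eta>)\<^sup>2) * d i"
        using d_bounds(3)[OF i] by (intro mult_right_mono) auto
      moreover have "(sqrt (t i) - sqrt (t (Suc i)))\<^sup>2 = \<eta> * q i"
      proof -
        have "sqrt (t j) = sqrt \<eta> * sin (a j)" if "j \<le> k" for j
          using sin_nonneg[OF that] by (simp add: t_def real_sqrt_mult)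
        then have "(sqrt (t i) - sqrt (t (Suc i)))\<^sup>2 = (sqrt \<eta>)\<^sup>2 * (sin (a i) - sin (a (Suc i)))\<^sup>2"
          using i by (simp add: power_mult_distrib[symmetric] right_diff_distrib)
        then show ?thesis
          using \<eta> by (simp add: q_def power2_commute)
      qed
      ultimately show "c i \<le> d i - \<eta> * \<kappa> * (d i * p i) + \<eta>\<^sup>2 * \<kappa>\<^sup>2 * d i + \<eta> * (C / 2) * (q i / d i)"
        by (simp add: c_def algebra_simps power_mult_distrib)
    qed
    also have "\<dots> = D - \<eta> * \<kappa> * (\<Sum>i<k. d i * p i) + \<eta>\<^sup>2 * \<kappa>\<^sup>2 * D
                     + \<eta> * (C / 2) * (\<Sum>i<k. q i / d i)"
      by (simp only: sum.distrib sum_subtractf sum_distrib_left[symmetric] sum_d)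
    \<comment> \<open>Since \<open>dist (w 0) (w k) = D\<close>, the terms of order zero cancel,
      leaving a common factor \<open>\<eta>\<close>.\<close>
    finally have "\<eta> * (\<kappa> * (\<Sum>i<k. d i * p i))
        \<le> \<eta> * (C / 2 * (\<Sum>i<k. q i / d i) + \<eta> * (\<kappa>\<^sup>2 * D))"
      using u(3) by (simp add: D_def algebra_simps power2_eq_square)
    then show "\<kappa> * (\<Sum>i<k. d i * p i) \<le> C / 2 * (\<Sum>i<k. q i / d i) + \<eta> * (\<kappa>\<^sup>2 * D)"
      using \<eta> by (simp only: mult_le_cancel_left_pos)
  qed
  \<comment> \<open>Steps of length at most \<open>2 * \<epsilon>\<close> are angular steps of at
    most \<open>2 * pi * \<epsilon> / D\<close>; this mesh is the source of the correction
    \<open>2 * pi * \<epsilon>\<close>.\<close>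
  have "pi / 2 * (1 - 2 * pi * \<epsilon> / D) \<le> (\<Sum>i<k. (a (Suc i) - a i) * p i)"
    unfolding p_def
  proof (rule sum_min_sin_sq_ge[OF a0 ak])
    show "a (Suc i) - a i \<le> 2 * pi * \<epsilon> / D" if "i < k" for i
      unfolding a_step using d_bounds(2)[OF that] D by (intro divide_right_mono) auto
  qed (use a_less in \<open>auto intro: less_imp_le\<close>)
  also have "\<dots> = pi / D * (\<Sum>i<k. d i * p i)"
    by (simp add: a_step sum_distrib_left mult.assoc)
  also have "pi / 2 * (1 - 2 * pi * \<epsilon> / D) = pi / D * ((D - 2 * pi * \<epsilon>) / 2)"
    using D by (simp add: field_simps)
  finally have P: "(D - 2 * pi * \<epsilon>) / 2 \<le> (\<Sum>i<k. d i * p i)"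
    using D by (subst (asm) mult_le_cancel_left_pos) auto
  \<comment> \<open>The factor \<open>D / pi\<close> turns lengths \<open>d i\<close> into angles,
    so that the \<open>cos\<close>-squared estimate applies.\<close>
  have "D / pi * (\<Sum>i<k. q i / d i) = (\<Sum>i<k. q i / (a (Suc i) - a i))"
    unfolding sum_distrib_left a_step by (intro sum.cong refl) simp
  also have "\<dots> \<le> pi / 2"
    unfolding q_def by (rule sum_sin_diff_sq_le[OF a0 ak a_less])
  finally have Q: "(\<Sum>i<k. q i / d i) \<le> pi\<^sup>2 / (2 * D)"
    using D by (simp add: field_simps power2_eq_square)
  have "\<kappa> * ((D - 2 * pi * \<epsilon>) / 2) \<le> \<kappa> * (\<Sum>i<k. d i * p i)"
    using P \<open>\<kappa> > 0\<close> by (intro mult_left_mono) auto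
  also note key
  also have "C / 2 * (\<Sum>i<k. q i / d i) \<le> C / 2 * (pi\<^sup>2 / (2 * D))"
    using Q \<open>C \<ge> 0\<close> by (intro mult_left_mono) auto
  finally have "D * (D - 2 * pi * \<epsilon>) \<le> pi\<^sup>2 * (C / (2 * \<kappa>))"
    using D \<open>\<kappa> > 0\<close> by (simp add: field_simps)
  then show ?thesis
    by (simp add: D_def)
qed

section \<open>From coarse chains to the diameter\<close>

theorem proposition51:
  fixes m :: "real \<Rightarrow> 'a::polish_space \<Rightarrow> 'a measure"
    and \<epsilon> \<kappa> C :: real
  assumes "continuous_time_random_walk m"
    and "\<epsilon> > 0"
    and "eps_geodesic \<epsilon> TYPE('a)"
    and "\<kappa> > 0" and "C \<ge> 0"
    and "\<exists>t\<^sub>0>0. \<forall>t\<in>{0..t\<^sub>0}. \<forall>t'\<in>{0..t\<^sub>0}. \<forall>x x'. \<epsilon> \<le> dist x x' \<and> dist x x' \<le> 2 * \<epsilon> \<longrightarrow>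
           transport_dist (m t x) (m t' x')
             \<le> ennreal (exp (- \<kappa> * min t t') * dist x x'
                        + C * (sqrt t - sqrt t')\<^sup>2 / (2 * dist x x'))"
    and "\<epsilon> \<le> 1 / 2 * sqrt (C / (2 * \<kappa>))"
  shows "bounded (UNIV :: 'a set) \<and>
         diameter (UNIV :: 'a set)
           \<le> pi * sqrt (C / (2 * \<kappa>)) * (1 + 4 * \<epsilon> / sqrt (C / (2 * \<kappa>)))"
proof -
  define R where "R = sqrt (C / (2 * \<kappa>))"
  \<comment> \<open>Positivity comes from \<open>0 < \<epsilon> \<le> R / 2\<close>.\<close>
  have R: "R > 0" "R\<^sup>2 = C / (2 * \<kappa>)"
    using assms(2,4,5,7) unfolding R_def by (linarith, simp)
  obtain t\<^sub>0 where t\<^sub>0: "t\<^sub>0 > 0"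
    "\<forall>t\<in>{0..t\<^sub>0}. \<forall>t'\<in>{0..t\<^sub>0}. \<forall>x x'. \<epsilon> \<le> dist x x' \<and> dist x x' \<le> 2 * \<epsilon> \<longrightarrow>
       transport_dist (m t x) (m t' x')
         \<le> ennreal (exp (- \<kappa> * min t t') * dist x x'
                    + C * (sqrt t - sqrt t')\<^sup>2 / (2 * dist x x'))"
    using assms(6) by blast
  have main: "dist x y \<le> pi * R + 4 * pi * \<epsilon>" for x y :: 'a
  proof -
    obtain k and w :: "nat \<Rightarrow> 'a" and u :: "nat \<Rightarrow> real" where
      w: "w 0 = x" "u 0 = 0" "dist x y < u k + \<epsilon>" "dist x (w k) = u k"
      "\<And>i. i < k \<Longrightarrow> dist (w i) (w (Suc i)) = u (Suc i) - u i"
      "\<And>i. i < k \<Longrightarrow> \<epsilon> \<le> u (Suc i) - u i" "\<And>i. i < k \<Longrightarrow> u (Suc i) - u i \<le> 2 * \<epsilon>"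
      using eps_geodesic_coarse_chain[OF assms(3,2)] by metis
    \<comment> \<open>Otherwise both factors of \<open>u k * (u k - 2 * pi * \<epsilon>)\<close>
      exceed \<open>pi * R\<close>, although the product is at most \<open>(pi * R)^2\<close>. The
      contrary assumption also supplies \<open>u k > 0\<close>.\<close>
    have "u k \<le> pi * R + 2 * pi * \<epsilon>"
    proof (rule ccontr)
      assume "\<not> ?thesis"
      then have less: "pi * R < u k - 2 * pi * \<epsilon>" "pi * R < u k"
        using assms(2) by (auto simp: algebra_simps) (smt (verit) mult_pos_pos pi_gt_zero)
      have pos: "0 < pi * R"
        using R by simp
      have "u k * (u k - 2 * pi * \<epsilon>) \<le> pi\<^sup>2 * (C / (2 * \<kappa>))"
        by (rule coarse_chain_length_le[OF assms(1,2,4,5) t\<^sub>0(1), where w = w])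
           (use t\<^sub>0(2) w less pos in auto)
      moreover have "(pi * R) * (pi * R) < u k * (u k - 2 * pi * \<epsilon>)"
        using less pos by (intro mult_strict_mono) auto
      moreover have "(pi * R) * (pi * R) = pi\<^sup>2 * (C / (2 * \<kappa>))"
        unfolding R(2)[symmetric] by (simp add: power2_eq_square)
      ultimately show False
        by linarith
    qed
    \<comment> \<open>The chain may stop short of \<open>y\<close> by less than
      \<open>\<epsilon>\<close>; this fits into the remaining
      \<open>2 * pi * \<epsilon>\<close>.\<close>
    moreover have "2 * \<epsilon> \<le> pi * \<epsilon>"
      using pi_ge_two assms(2) by (intro mult_right_mono) auto
    ultimately show ?thesis
      using w(3) assms(2) by linarith
  qed
  have eq: "pi * R * (1 + 4 * \<epsilon> / R) = pi * R + 4 * pi * \<epsilon>"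
    using R by (simp add: field_simps)
  have "bounded (UNIV :: 'a set)"
    unfolding bounded_def using main by blast
  moreover have "diameter (UNIV :: 'a set) \<le> pi * R + 4 * pi * \<epsilon>"
    unfolding diameter_def using main by (auto intro!: cSUP_least)
  ultimately show ?thesis
    using eq by (simp add: R_def)
qed

end
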